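(* There are no non-trivial transposed Poisson algebra structures defined on the complex Virasoro algebra $\mathbf{Vir}$.
   Context: The Virasoro algebra $\mathbf{Vir}$ is the complex Lie algebra with basis $\{L_n\}_{n\in\mathbb{Z}}\cup\{c\}$, where $c$ is central and $[L_m,L_n]=(m-n)L_{m+n}+\frac{m^3-m}{12}\delta_{m+n,0}\,c$. A transposed Poisson algebra structure on a complex Lie algebra $(\mathfrak{L},[\;,\;])$ is a bilinear operation $\cdot$ on $\mathfrak{L}$ such that $(\mathfrak{L},\cdot)$ is commutative and associative (not necessarily unital) and $2z\cdot[x,y]=[z\cdot x,y]+[x,z\cdot y]$ for all $x,y,z\in\mathfrak{L}$. The structure is non-trivial if both operations $\cdot$ and $[\;,\;]$ are not identically zero. *)

theory Defs
  imports Complex_Main "HOL-Library.Poly_Mapping"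
begin

definition bilinear_op :: "('k::field \<Rightarrow> 'a::ab_group_add \<Rightarrow> 'a) \<Rightarrow> ('a \<Rightarrow> 'a \<Rightarrow> 'a) \<Rightarrow> bool"
  where "bilinear_op scale f \<longleftrightarrow>
    (\<forall>x. Vector_Spaces.linear scale scale (f x)) \<and>
    (\<forall>y. Vector_Spaces.linear scale scale (\<lambda>x. f x y))"

locale complex_lie_algebra = vector_space scale
  for scale :: "complex \<Rightarrow> 'a::ab_group_add \<Rightarrow> 'a" +
  fixes bracket :: "'a \<Rightarrow> 'a \<Rightarrow> 'a"
  assumes bracket_bilinear: "bilinear_op scale bracket"
    and bracket_self: "bracket x x = 0"
    and jacobi: "bracket x (bracket y z) + bracket y (bracket z x) + bracket z (bracket x y) = 0"

locale transposed_poisson_algebra = complex_lie_algebra scale bracket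
  for scale :: "complex \<Rightarrow> 'a::ab_group_add \<Rightarrow> 'a" and bracket :: "'a \<Rightarrow> 'a \<Rightarrow> 'a" +
  fixes mult :: "'a \<Rightarrow> 'a \<Rightarrow> 'a"
  assumes mult_bilinear: "bilinear_op scale mult"
    and mult_commute: "mult x y = mult y x"
    and mult_assoc: "mult (mult x y) z = mult x (mult y z)"
    and transposed_leibniz:
      "scale 2 (mult z (bracket x y)) = bracket (mult z x) y + bracket x (mult z y)"

definition nontrivial_structure :: "('a \<Rightarrow> 'a \<Rightarrow> 'a::zero) \<Rightarrow> ('a \<Rightarrow> 'a \<Rightarrow> 'a) \<Rightarrow> bool"
  where "nontrivial_structure bracket mult \<longleftrightarrow>
    (\<exists>x y. mult x y \<noteq> 0) \<and> (\<exists>x y. bracket x y \<noteq> 0)"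


datatype vir_index = Mode int | Central

text \<open>
  The underlying space of the Virasoro algebra is the free complex vector space on
  \<open>vir_index\<close>, i.e. the finitely supported coefficient functions.
\<close>

type_synonym vir = "vir_index \<Rightarrow>\<^sub>0 complex"

definition vir_scale :: "complex \<Rightarrow> vir \<Rightarrow> vir"
  where "vir_scale a x = Poly_Mapping.map ((*) a) x"

definition vir_L :: "int \<Rightarrow> vir"
  where "vir_L n = Poly_Mapping.single (Mode n) 1"

definition vir_c :: vir
  where "vir_c = Poly_Mapping.single Central 1"

fun vir_basis_bracket :: "vir_index \<Rightarrow> vir_index \<Rightarrow> vir" where
  "vir_basis_bracket (Mode m) (Mode n) =
     vir_scale (of_int (m - n)) (vir_L (m + n)) +
     vir_scale (if m + n = 0 then of_int (m ^ 3 - m) / 12 else 0) vir_c"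
| "vir_basis_bracket Central _ = 0"
| "vir_basis_bracket _ Central = 0"

definition vir_bracket :: "vir \<Rightarrow> vir \<Rightarrow> vir"
  where "vir_bracket x y =
    (\<Sum>i\<in>Poly_Mapping.keys x. \<Sum>j\<in>Poly_Mapping.keys y.
       vir_scale (Poly_Mapping.lookup x i * Poly_Mapping.lookup y j) (vir_basis_bracket i j))"


lemma lookup_vir_scale [simp]:
  "Poly_Mapping.lookup (vir_scale a x) i = a * Poly_Mapping.lookup x i"
  by (simp add: vir_scale_def Poly_Mapping.map.rep_eq when_def)

interpretation vir: vector_space vir_scale
  by unfold_locales (auto intro!: poly_mapping_eqI simp: lookup_add algebra_simps)

definition vir_extend :: "(vir_index \<Rightarrow> vir) \<Rightarrow> vir \<Rightarrow> vir"
  where "vir_extend f x =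
    (\<Sum>i\<in>Poly_Mapping.keys x. vir_scale (Poly_Mapping.lookup x i) (f i))"

lemma vir_extend_superset:
  assumes "finite A" "Poly_Mapping.keys x \<subseteq> A"
  shows "vir_extend f x = (\<Sum>i\<in>A. vir_scale (Poly_Mapping.lookup x i) (f i))"
  unfolding vir_extend_def
  by (rule sum.mono_neutral_left) (use assms in \<open>auto simp: in_keys_iff\<close>)

lemma linear_vir_extend: "Vector_Spaces.linear vir_scale vir_scale (vir_extend f)"
proof (unfold_locales)
  fix x y :: vir and a :: complex
  let ?A = "Poly_Mapping.keys x \<union> Poly_Mapping.keys y"
  have k: "Poly_Mapping.keys (x + y) \<subseteq> ?A"
    by (rule Poly_Mapping.keys_add)
  show "vir_extend f (x + y) = vir_extend f x + vir_extend f y"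
    by (simp add: vir_extend_superset[OF _ k] vir_extend_superset[of ?A x]
        vir_extend_superset[of ?A y] lookup_add vir.scale_left_distrib sum.distrib)
  have k': "Poly_Mapping.keys (vir_scale a x) \<subseteq> Poly_Mapping.keys x"
    by (auto simp: in_keys_iff)
  show "vir_extend f (vir_scale a x) = vir_scale a (vir_extend f x)"
    by (simp add: vir_extend_superset[OF _ k'] vir_extend_superset[of "Poly_Mapping.keys x" x]
        vir.scale_sum_right)
qed

lemma vir_extend_single: "vir_extend f (Poly_Mapping.single i 1) = f i"
  by (simp add: vir_extend_def)

lemma vir_bracket_extend:
  "vir_bracket x y = vir_extend (\<lambda>i. vir_extend (vir_basis_bracket i) y) x"
  by (simp add: vir_bracket_def vir_extend_def vir.scale_sum_right)

lemma vir_bracket_extend':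
  "vir_bracket x y = vir_extend (\<lambda>j. vir_extend (\<lambda>i. vir_basis_bracket i j) x) y"
  unfolding vir_bracket_def vir_extend_def
  by (subst sum.swap) (simp add: vir.scale_sum_right mult.commute)

lemma bilinear_vir_bracket: "bilinear_op vir_scale vir_bracket"
  unfolding bilinear_op_def
proof (intro conjI allI)
  show "Vector_Spaces.linear vir_scale vir_scale (vir_bracket x)" for x
    using linear_vir_extend[of "\<lambda>j. vir_extend (\<lambda>i. vir_basis_bracket i j) x"]
    by (simp add: vir_bracket_extend'[abs_def])
  show "Vector_Spaces.linear vir_scale vir_scale (\<lambda>x. vir_bracket x y)" for y
    using linear_vir_extend[of "\<lambda>i. vir_extend (vir_basis_bracket i) y"]
    by (simp add: vir_bracket_extend)
qed

lemma vir_bracket_single: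
  "vir_bracket (Poly_Mapping.single i 1) (Poly_Mapping.single j 1) = vir_basis_bracket i j"
  by (simp add: vir_bracket_extend vir_extend_single)

theorem vir_bracket_L:
  "vir_bracket (vir_L m) (vir_L n) =
     vir_scale (of_int (m - n)) (vir_L (m + n)) +
     vir_scale (if m + n = 0 then of_int (m ^ 3 - m) / 12 else 0) vir_c"
  by (simp only: vir_L_def[of m] vir_L_def[of n] vir_bracket_single vir_basis_bracket.simps)

lemma vir_expand:
  "(x :: vir) = (\<Sum>i\<in>Poly_Mapping.keys x.
     vir_scale (Poly_Mapping.lookup x i) (Poly_Mapping.single i 1))"
  by (rule poly_mapping_eqI)
    (auto simp: lookup_sum lookup_single when_def in_keys_iff if_distrib sum.delta cong: if_cong)

lemma vir_basis_induct [case_names add scale basis]: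
  assumes add: "\<And>x y. P x \<Longrightarrow> P y \<Longrightarrow> P (x + y)"
    and scale: "\<And>a x. P x \<Longrightarrow> P (vir_scale a x)"
    and L: "\<And>i. P (Poly_Mapping.single i 1)"
  shows "P x"
proof -
  have "P 0"
    using scale[OF L, of 0] by simp
  then have "P (\<Sum>i\<in>A. vir_scale (Poly_Mapping.lookup x i) (Poly_Mapping.single i 1))" for A
    by (induction A rule: infinite_finite_induct) (auto intro: assms)
  then show ?thesis
    by (subst vir_expand)
qed

lemma
  shows vir_bracket_add_left: "vir_bracket (x + y) z = vir_bracket x z + vir_bracket y z"
    and vir_bracket_add_right: "vir_bracket z (x + y) = vir_bracket z x + vir_bracket z y"
    and vir_bracket_scale_left: "vir_bracket (vir_scale a x) z = vir_scale a (vir_bracket x z)"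
    and vir_bracket_scale_right: "vir_bracket z (vir_scale a x) = vir_scale a (vir_bracket z x)"
  using bilinear_vir_bracket
  by (auto simp: bilinear_op_def Vector_Spaces.linear_iff)

lemmas vir_bracket_bilinear_simps =
  vir_bracket_add_left vir_bracket_add_right vir_bracket_scale_left vir_bracket_scale_right

theorem vir_c_central: "vir_bracket vir_c x = 0" "vir_bracket x vir_c = 0"
proof -
  have "vir_basis_bracket i Central = 0" for i
    by (cases i) auto
  then show "vir_bracket vir_c x = 0" "vir_bracket x vir_c = 0"
    by (simp_all add: vir_bracket_extend vir_bracket_extend' vir_c_def vir_extend_def)
qed

lemma vir_index_cases_basis:
  "(\<exists>n. Poly_Mapping.single i 1 = vir_L n) \<or> Poly_Mapping.single i 1 = vir_c"
  by (cases i) (auto simp: vir_L_def vir_c_def)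

lemma vir_bracket_anticommute: "vir_bracket x y = - vir_bracket y x"
proof (induction x rule: vir_basis_induct)
  case (basis i)
  show ?case
  proof (induction y rule: vir_basis_induct)
    case (basis j)
    show ?case
      using vir_index_cases_basis[of i] vir_index_cases_basis[of j]
    proof (elim disjE exE)
      fix m n
      assume eqs: "Poly_Mapping.single i 1 = vir_L m" "Poly_Mapping.single j 1 = vir_L n"
      show ?thesis
      proof (cases "m + n = 0")
        case True
        then have "n = - m" by simp
        then show ?thesis
          unfolding eqs vir_bracket_L
          by (intro poly_mapping_eqI) (simp add: lookup_add lookup_minus field_simps)
      next
        case False
        then show ?thesis
          unfolding eqs vir_bracket_L
          by (intro poly_mapping_eqI) (simp add: lookup_add lookup_minus algebra_simps)
      qed
    qed (simp_all add: vir_c_central)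
  qed (simp_all add: vir_bracket_bilinear_simps)
qed (simp_all add: vir_bracket_bilinear_simps)

lemma vir_jacobi_L:
  "vir_bracket (vir_L l) (vir_bracket (vir_L m) (vir_L n)) +
   vir_bracket (vir_L m) (vir_bracket (vir_L n) (vir_L l)) +
   vir_bracket (vir_L n) (vir_bracket (vir_L l) (vir_L m)) = 0"
proof -
  have L: "vir_bracket (vir_L l) (vir_bracket (vir_L m) (vir_L n)) =
     vir_scale (of_int ((m - n) * (l - (m + n)))) (vir_L (l + m + n)) +
     vir_scale (if l + m + n = 0 then of_int ((m - n) * (l ^ 3 - l)) / 12 else 0) vir_c" for l m n
    by (auto simp: vir_bracket_L vir_bracket_bilinear_simps vir_c_central add.assoc
        vir.scale_right_distrib)
  have perm: "m + n + l = l + m + n" "n + l + m = l + m + n"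
    by simp_all
  have L0: "(m - n) * (l - (m + n)) + (n - l) * (m - (n + l)) + (l - m) * (n - (l + m)) = 0"
    by (simp add: algebra_simps)
  have C0: "(m - n) * (l ^ 3 - l) + (n - l) * (m ^ 3 - m) + (l - m) * (n ^ 3 - n) = 0"
    if "l + m + n = 0"
  proof -
    from that have "n = - l - m" by linarith
    show ?thesis unfolding \<open>n = - l - m\<close> by (simp add: algebra_simps power3_eq_cube)
  qed
  let ?c = "\<lambda>k. if l + m + n = 0 then of_int k / 12 else 0 :: complex"
  have "vir_bracket (vir_L l) (vir_bracket (vir_L m) (vir_L n)) +
     vir_bracket (vir_L m) (vir_bracket (vir_L n) (vir_L l)) +
     vir_bracket (vir_L n) (vir_bracket (vir_L l) (vir_L m)) =
     vir_scale (of_int ((m - n) * (l - (m + n)) + (n - l) * (m - (n + l)) + (l - m) * (n - (l + m))))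
       (vir_L (l + m + n)) +
     vir_scale (?c ((m - n) * (l ^ 3 - l) + (n - l) * (m ^ 3 - m) + (l - m) * (n ^ 3 - n))) vir_c"
    unfolding L perm
    by (simp only: of_int_add vir.scale_left_distrib add_divide_distrib split: if_splits)
      (simp add: algebra_simps)
  also have "\<dots> = 0"
    using C0 by (simp only: L0) simp
  finally show ?thesis .
qed

theorem vir_lie_algebra: "complex_lie_algebra vir_scale vir_bracket"
proof unfold_locales
  show "bilinear_op vir_scale vir_bracket"
    by (rule bilinear_vir_bracket)
next
  fix x
  have "vir_bracket x x = - vir_bracket x x"
    by (rule vir_bracket_anticommute)
  then have "Poly_Mapping.lookup (vir_bracket x x) i =
    - Poly_Mapping.lookup (vir_bracket x x) i" for i
    by (metis lookup_uminus)
  then show "vir_bracket x x = 0"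
    by (intro poly_mapping_eqI) (simp add: equal_neg_zero)
next
  fix x y z
  define J where "J = (\<lambda>x y z. vir_bracket x (vir_bracket y z) +
    vir_bracket y (vir_bracket z x) + vir_bracket z (vir_bracket x y))"
  have add: "J (x + x') y z = J x y z + J x' y z"
    and scale: "J (vir_scale a x) y z = vir_scale a (J x y z)"
    and rot: "J x y z = J y z x" for a x x' y z
    by (simp_all add: J_def vir_bracket_bilinear_simps vir.scale_right_distrib algebra_simps)
  let ?e = "\<lambda>i. Poly_Mapping.single i 1 :: vir"
  have zero: "vir_bracket 0 x = 0" "vir_bracket x 0 = 0" for x
    by (simp_all add: vir_bracket_def)
  have basis: "J (?e i) (?e j) (?e k) = 0" for i j k
    using vir_index_cases_basis[of i] vir_index_cases_basis[of j] vir_index_cases_basis[of k]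
    by (elim disjE exE) (simp_all add: J_def vir_jacobi_L vir_c_central zero)
  have 1: "J x (?e j) (?e k) = 0" for x j k
    by (induction x rule: vir_basis_induct) (simp_all add: add scale basis)
  have 2: "J y (?e k) x = 0" for x y k
    by (induction y rule: vir_basis_induct) (simp_all add: add scale, metis 1 rot)
  have "J z x y = 0"
    by (induction z rule: vir_basis_induct) (simp_all add: add scale, metis 2 rot)
  then show "vir_bracket x (vir_bracket y z) + vir_bracket y (vir_bracket z x) +
    vir_bracket z (vir_bracket x y) = 0"
    using rot[of z x y] by (simp add: J_def)
qed

end

theory Submission
  imports Defs
begin

text \<open>
  For fixed \<open>z\<close>, the compatibility condition says that \<open>\<phi> x = z \<cdot> x\<close> satisfies
  \<open>2 \<phi> [x, y] = [\<phi> x, y] + [x, \<phi> y]\<close>; such a linear map is called a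
  \<open>\<onehalf>\<close>-derivation. The heart of the matter is that every \<open>\<onehalf>\<close>-derivation of the
  Virasoro algebra is a scalar. Granting this, \<open>z \<cdot> x = \<lambda>(z) x\<close> for all \<open>z\<close> and \<open>x\<close>, and
  commutativity gives \<open>\<lambda>(z) x = \<lambda>(x) z\<close>; choosing \<open>x\<close> not proportional to \<open>z\<close> forces
  \<open>\<lambda>(z) = 0\<close>.

  To see that \<open>\<phi>\<close> is a scalar, split it into homogeneous parts: the part of degree \<open>d\<close> sends
  \<open>L\<^sub>m\<close> to \<open>\<alpha>\<^sub>d(m) L\<^sub>m\<^sub>+\<^sub>d\<close>, up to the centre. The \<open>L\<close>-components of the identity form the linear
  relation of lemma \<open>shift_relation\<close> between the numbers \<open>\<alpha>\<^sub>d(m)\<close>, and force \<open>\<alpha>\<^sub>d(m)\<close> to be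
  independent of \<open>m\<close>. Modulo the centre this is all that can be said: the Witt algebra does have
  \<open>\<onehalf>\<close>-derivations \<open>L\<^sub>m \<mapsto> L\<^sub>m\<^sub>+\<^sub>d\<close> for every \<open>d\<close>. It is the cocycle that excludes them: the
  \<open>c\<close>-component of the identity (lemma \<open>central_relation\<close>), taken at two different pairs
  \<open>(m, n)\<close> with the same sum \<open>s \<noteq> 0\<close>, gives two independent equations for \<open>\<alpha>\<^sub>-\<^sub>s\<close> and the
  \<open>c\<close>-coefficient of \<open>\<phi> L\<^sub>s\<close>, so that both vanish. Only degree \<open>0\<close> survives, and the pairs
  with \<open>m + n = 0\<close> then show that \<open>\<phi>\<close> multiplies \<open>c\<close> by the same scalar \<open>\<alpha>\<^sub>0\<close> as the \<open>L\<^sub>m\<close>.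
\<close>

section \<open>Coefficients of a bracket with a basis vector\<close>

lemma lookup_vir_L: "Poly_Mapping.lookup (vir_L n) i = (if i = Mode n then 1 else 0)"
  by (simp add: vir_L_def lookup_single when_def)

lemma lookup_vir_c: "Poly_Mapping.lookup vir_c i = (if i = Central then 1 else 0)"
  by (simp add: vir_c_def lookup_single when_def)

lemma lookup_bracket_L_Mode:
  "Poly_Mapping.lookup (vir_bracket x (vir_L n)) (Mode j) =
     of_int (j - 2 * n) * Poly_Mapping.lookup x (Mode (j - n))"
proof (induction x rule: vir_basis_induct)
  case (basis i)
  show ?case
    using vir_index_cases_basis[of i]
    by (elim disjE exE)
      (auto simp: vir_bracket_L vir_c_central lookup_add lookup_vir_L lookup_vir_c)
qed (simp_all add: vir_bracket_bilinear_simps lookup_add distrib_left mult.left_commute)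

lemma lookup_bracket_L_Central:
  "Poly_Mapping.lookup (vir_bracket x (vir_L n)) Central =
     of_int (n - n ^ 3) / 12 * Poly_Mapping.lookup x (Mode (- n))"
proof (induction x rule: vir_basis_induct)
  case (add x y)
  then show ?case
    by (simp add: vir_bracket_add_left lookup_add field_simps)
next
  case (basis i)
  show ?case
    using vir_index_cases_basis[of i]
  proof (elim disjE exE)
    fix m
    assume eq: "Poly_Mapping.single i 1 = vir_L m"
    show ?thesis
    proof (cases "m = - n")
      case True
      then show ?thesis
        unfolding eq
        by (simp add: vir_bracket_L lookup_add lookup_minus lookup_vir_L lookup_vir_c)
    next
      case False
      then show ?thesis
        unfolding eq
        by (auto simp: vir_bracket_L lookup_add lookup_vir_L lookup_vir_c)
    qed
  qed (simp add: vir_c_central lookup_vir_c)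
qed (simp_all add: vir_bracket_scale_left)

section \<open>Half-derivations of the Virasoro algebra\<close>

locale vir_half_derivation =
  fixes \<phi> :: "vir \<Rightarrow> vir"
  assumes linear: "Vector_Spaces.linear vir_scale vir_scale \<phi>"
    and half_leibniz:
      "vir_scale 2 (\<phi> (vir_bracket x y)) = vir_bracket (\<phi> x) y + vir_bracket x (\<phi> y)"
begin

lemma
  shows map_add: "\<phi> (x + y) = \<phi> x + \<phi> y"
    and map_scale: "\<phi> (vir_scale a x) = vir_scale a (\<phi> x)"
  using linear by (auto simp: Vector_Spaces.linear_iff)

text \<open>
  \<open>shift d m\<close> is the coefficient \<open>\<alpha>\<^sub>d(m)\<close> of the homogeneous part of degree \<open>d\<close>.
\<close>

definition shift :: "int \<Rightarrow> int \<Rightarrow> complex"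
  where "shift d m = Poly_Mapping.lookup (\<phi> (vir_L m)) (Mode (m + d))"

lemma half_leibniz_L:
  "vir_scale 2 (vir_scale (of_int (m - n)) (\<phi> (vir_L (m + n))) +
     vir_scale (if m + n = 0 then of_int (m ^ 3 - m) / 12 else 0) (\<phi> vir_c)) =
   vir_bracket (\<phi> (vir_L m)) (vir_L n) - vir_bracket (\<phi> (vir_L n)) (vir_L m)"
  using half_leibniz[of "vir_L m" "vir_L n"] vir_bracket_anticommute[of "vir_L m" "\<phi> (vir_L n)"]
  by (simp add: vir_bracket_L map_add map_scale)

lemma shift_relation:
  "2 * of_int (m - n) * shift d (m + n) +
     (if m + n = 0 then of_int (m ^ 3 - m) / 6 else 0) * Poly_Mapping.lookup (\<phi> vir_c) (Mode d) =
   of_int (m - n + d) * shift d m + of_int (m - n - d) * shift d n"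
proof -
  define e :: complex where "e = (if m + n = 0 then of_int (m ^ 3 - m) / 12 else 0)"
  have e: "(if m + n = 0 then of_int (m ^ 3 - m) / 6 else 0) = 2 * e"
    by (simp add: e_def)
  have cocycle: "e * Poly_Mapping.lookup x (Mode (m + n + d)) = e * Poly_Mapping.lookup x (Mode d)"
    for x
    by (simp add: e_def)
  have "m + n + d - n = m + d" "m + n + d - m = n + d"
    by simp_all
  then show ?thesis
    using arg_cong[OF half_leibniz_L[of m n, folded e_def],
        of "\<lambda>x. Poly_Mapping.lookup x (Mode (m + n + d))"]
    unfolding e
    by (simp add: lookup_add lookup_minus lookup_bracket_L_Mode shift_def distrib_left cocycle)
      (simp add: algebra_simps)
qed

lemma central_relation:
  "2 * of_int (m - n) * Poly_Mapping.lookup (\<phi> (vir_L (m + n))) Central +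
     (if m + n = 0 then of_int (m ^ 3 - m) / 6 else 0) * Poly_Mapping.lookup (\<phi> vir_c) Central =
   of_int (m ^ 3 - m - n ^ 3 + n) / 12 * shift (- (m + n)) m"
  if "shift (- (m + n)) n = shift (- (m + n)) m"
proof -
  define e :: complex where "e = (if m + n = 0 then of_int (m ^ 3 - m) / 12 else 0)"
  have e: "(if m + n = 0 then of_int (m ^ 3 - m) / 6 else 0) = 2 * e"
    by (simp add: e_def)
  have "m + - (m + n) = - n" "n + - (m + n) = - m"
    by simp_all
  then show ?thesis
    using arg_cong[OF half_leibniz_L[of m n, folded e_def],
        of "\<lambda>x. Poly_Mapping.lookup x Central"] that
    unfolding e
    by (simp add: lookup_add lookup_minus lookup_bracket_L_Central shift_def
        add_divide_distrib diff_divide_distrib algebra_simps)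
qed

text \<open>
  Bracketing with \<open>L\<^sub>0\<close> settles every \<open>m \<noteq> d\<close>; the exceptional index \<open>m = d\<close> is reached as
  \<open>2d + (- d)\<close>, a sum of two indices that are already settled.
\<close>

lemma shift_const: "shift d m = shift d 0"
proof -
  have off: "shift d k = shift d 0" if "k \<noteq> d" for k
  proof -
    have "of_int (k - d) * shift d k = of_int (k - d) * shift d 0"
      using shift_relation[of k 0 d] by (cases "k = 0") (simp_all add: algebra_simps)
    with that show ?thesis by simp
  qed
  show ?thesis
  proof (cases "m = d \<and> d \<noteq> 0")
    case True
    then have "of_int (6 * d) * shift d d = of_int (6 * d) * shift d 0"
      using shift_relation[of "2 * d" "- d" d] off[of "2 * d"] off[of "- d"]
      by (simp add: algebra_simps)
    with True show ?thesis by simp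
  next
    case False
    then show ?thesis
      using off[of m] by auto
  qed
qed

text \<open>
  The cocycle term contributes to the pair \<open>(2, -2)\<close>, whereas the terms in \<open>\<alpha>\<^sub>d\<close> cancel.
\<close>

lemma lookup_map_c_Mode: "Poly_Mapping.lookup (\<phi> vir_c) (Mode d) = 0"
  using shift_relation[of 2 "-2" d] shift_const[of d 2] shift_const[of d "-2"]
  by (simp add: algebra_simps)

text \<open>
  For \<open>m + n = s\<close> the central relation reads \<open>24 b = (s\<^sup>2 - m n - 1) \<alpha>\<^sub>-\<^sub>s\<close> after
  division by \<open>m - n\<close>, where \<open>b\<close> is the \<open>c\<close>-coefficient of \<open>\<phi> L\<^sub>s\<close>; the pairs \<open>(s, 0)\<close> and \<open>(2s, - s)\<close> give different values of \<open>m n\<close>.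
\<close>

lemma
  assumes "s \<noteq> 0"
  shows shift_eq_0: "shift (- s) m = 0"
    and lookup_map_L_Central: "Poly_Mapping.lookup (\<phi> (vir_L s)) Central = 0"
proof -
  define b where "b = Poly_Mapping.lookup (\<phi> (vir_L s)) Central"
  define a where "a = shift (- s) 0"
  define t :: complex where "t = of_int s"
  have t: "t \<noteq> 0"
    using assms by (simp add: t_def)
  have a: "shift (- s) k = a" for k
    unfolding a_def by (rule shift_const)
  have "2 * t * b = (t ^ 3 - t) / 12 * a"
    using central_relation[of s 0] a assms by (simp add: b_def t_def)
  then have "t * (24 * b) = t * ((t ^ 2 - 1) * a)"
    by (simp add: field_simps power2_eq_square power3_eq_cube)
  then have 1: "24 * b = (t ^ 2 - 1) * a"
    using t by (simp only: mult_cancel_left) simp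
  have "6 * t * b = (9 * t ^ 3 - 3 * t) / 12 * a"
    using central_relation[of "2 * s" "- s"] a assms
    by (simp add: b_def t_def power_mult_distrib)
  then have "(3 * t) * (24 * b) = (3 * t) * ((3 * t ^ 2 - 1) * a)"
    by (simp add: field_simps power2_eq_square power3_eq_cube)
  then have 2: "24 * b = (3 * t ^ 2 - 1) * a"
    using t by (simp only: mult_cancel_left) simp
  from 1 2 have "t ^ 2 * a = 0"
    by (simp add: algebra_simps)
  with t have "a = 0" by simp
  with a show "shift (- s) m = 0" by simp
  from 1 \<open>a = 0\<close> show "Poly_Mapping.lookup (\<phi> (vir_L s)) Central = 0"
    by (simp add: b_def)
qed

text \<open>
  In degree zero the coefficient \<open>m\<^sup>3 - m\<close> vanishes at the pair \<open>(1, -1)\<close>, which isolates the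
  \<open>c\<close>-coefficient of \<open>\<phi> L\<^sub>0\<close>.
\<close>

lemma lookup_map_L0_Central: "Poly_Mapping.lookup (\<phi> (vir_L 0)) Central = 0"
  using central_relation[of 1 "-1"] shift_const[of 0 1] shift_const[of 0 "-1"] by simp

lemma lookup_map_c_Central: "Poly_Mapping.lookup (\<phi> vir_c) Central = shift 0 0"
  using central_relation[of 2 "-2"] shift_const[of 0 2] shift_const[of 0 "-2"]
  by (simp add: lookup_map_L0_Central)

lemma map_L: "\<phi> (vir_L m) = vir_scale (shift 0 0) (vir_L m)"
proof (rule poly_mapping_eqI)
  fix i
  show "Poly_Mapping.lookup (\<phi> (vir_L m)) i =
    Poly_Mapping.lookup (vir_scale (shift 0 0) (vir_L m)) i"
  proof (cases i)
    case (Mode j)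
    have "Poly_Mapping.lookup (\<phi> (vir_L m)) (Mode j) = shift (j - m) m"
      by (simp add: shift_def)
    then show ?thesis
      using shift_eq_0[of "m - j" m] shift_const[of 0 m] Mode
      by (cases "j = m") (simp_all add: lookup_vir_L)
  next
    case Central
    then show ?thesis
      using lookup_map_L_Central[of m] lookup_map_L0_Central
      by (cases "m = 0") (simp_all add: lookup_vir_L)
  qed
qed

lemma map_c: "\<phi> vir_c = vir_scale (shift 0 0) vir_c"
proof (rule poly_mapping_eqI)
  show "Poly_Mapping.lookup (\<phi> vir_c) i =
    Poly_Mapping.lookup (vir_scale (shift 0 0) vir_c) i" for i
    by (cases i) (simp_all add: lookup_vir_c lookup_map_c_Mode lookup_map_c_Central)
qed

theorem half_derivation_scalar: "\<phi> x = vir_scale (shift 0 0) x"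
proof (induction x rule: vir_basis_induct)
  case (basis i)
  show ?case
    using vir_index_cases_basis[of i] by (elim disjE exE) (simp_all only: map_L map_c)
qed (simp_all add: map_add map_scale vir.scale_right_distrib mult.commute)

end

section \<open>Triviality of transposed Poisson structures\<close>

theorem corollary27:
  shows "\<not> (\<exists>mult :: vir \<Rightarrow> vir \<Rightarrow> vir.
           transposed_poisson_algebra vir_scale vir_bracket mult \<and>
           nontrivial_structure vir_bracket mult)"
proof
  assume "\<exists>mult :: vir \<Rightarrow> vir \<Rightarrow> vir.
           transposed_poisson_algebra vir_scale vir_bracket mult \<and>
           nontrivial_structure vir_bracket mult"
  then obtain mult :: "vir \<Rightarrow> vir \<Rightarrow> vir"
    where tp: "transposed_poisson_algebra vir_scale vir_bracket mult"
      and nontrivial: "nontrivial_structure vir_bracket mult"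
    by blast
  interpret transposed_poisson_algebra vir_scale vir_bracket mult
    by (fact tp)
  have "vir_half_derivation (mult z)" for z
    using mult_bilinear transposed_leibniz
    by (simp add: bilinear_op_def vir_half_derivation_def)
  then have "\<forall>z. \<exists>l. \<forall>x. mult z x = vir_scale l x"
    using vir_half_derivation.half_derivation_scalar by blast
  then obtain l where l: "mult z x = vir_scale (l z) x" for z x
    by metis
  have "l z = 0" for z
  proof -
    have comm: "l x * Poly_Mapping.lookup y i = l y * Poly_Mapping.lookup x i" for x y i
      using arg_cong[OF mult_commute[of x y], of "\<lambda>v. Poly_Mapping.lookup v i"] by (simp add: l)
    (* The comparison with vir_c makes l vanish at vir_L 0; this one vector then suffices to
       make l vanish at every z, by reading off the coefficient of vir_L 0. *)
    have "l (vir_L 0) = 0"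
      using comm[of "vir_L 0" vir_c Central] by (simp add: lookup_vir_L lookup_vir_c)
    then show ?thesis
      using comm[of z "vir_L 0" "Mode 0"] by (simp add: lookup_vir_L)
  qed
  then have "mult x y = 0" for x y
    by (simp add: l)
  with nontrivial show False
    by (simp add: nontrivial_structure_def)
qed

end
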